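(* A simple game $G$ on a finite set of players is a conjunctive hierarchical game (for some partition of the players into levels $P_1,\dots,P_m$ and some positive thresholds $k_1<\dots<k_{m-1}\le k_m$) if and only if $G$ is complete and its canonical representation has exactly one shift-minimal winning coalition.
   Context: A simple game on a finite set $P$ is a pair $(P,W)$ with $W$ a nonempty family of subsets of $P$ closed under supersets (winning coalitions). The conjunctive hierarchical game with partition $P=P_1\cup\dots\cup P_m$ and thresholds $k_1<\dots<k_{m-1}\le k_m$ has as winning coalitions those $X$ with $|X\cap(P_1\cup\dots\cup P_i)|\ge k_i$ for all $i$. Isbell's desirability relation: $i\succeq_G j$ iff for every $X\subseteq P$ containing neither $i$ nor $j$, $X\cup\{j\}\in W$ implies $X\cup\{i\}\in W$; $G$ is complete if $\succeq_G$ is a total preorder. Players $i,j$ are equivalent if $i\succeq_G j$ and $j\succeq_G i$. If the equivalence classes have sizes $n_1,\dots,n_m$, numbered so that class 1 is strictly more desirable than class 2, etc., the canonical representation is the game on the multiset $\{1^{n_1},\dots,m^{n_m}\}$ in which $\{1^{\ell_1},\dots,m^{\ell_m}\}$ ($0\le\ell_i\le n_i$) is winning iff a coalition with $\ell_i$ players from class $i$ for each $i$ is winning. In this multiset game, $A'$ is obtained from $A=\{1^{\ell_1},\dots,m^{\ell_m}\}$ by a shift if for some $i<j$ with $\ell_i\ge1$ and $\ell_j<n_j$, $A'$ has multiplicities $\ell_i-1$ at $i$, $\ell_j+1$ at $j$ and the same as $A$ elsewhere. A winning submultiset $X$ is shift-minimal if every submultiset strictly contained in $X$ is losing and every submultiset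 obtained from $X$ by a shift is losing.
   Formalization: The empty coalition is assumed to be losing. This excludes only the game in which every coalition wins; that game is complete with exactly one shift-minimal winning coalition (the empty one), yet is not hierarchical with positive thresholds, so the claim fails for it. *)

theory Defs
  imports Main "HOL-Library.Multiset" "HOL-Library.Disjoint_Sets"
begin

definition simple_game :: "'a set \<Rightarrow> 'a set set \<Rightarrow> bool" where
  "simple_game P W \<longleftrightarrow>
     finite P \<and> W \<subseteq> Pow P \<and> W \<noteq> {} \<and> (\<forall>X Y. X \<in> W \<and> X \<subseteq> Y \<and> Y \<subseteq> P \<longrightarrow> Y \<in> W)"

text \<open>The condition on \<open>k (m - 1)\<close> is guarded because for a single level there is no
  threshold preceding \<open>k m\<close>.\<close>

definition conjunctive_hierarchical :: "'a set \<Rightarrow> 'a set set \<Rightarrow> bool" where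
  "conjunctive_hierarchical P W \<longleftrightarrow>
     (\<exists>(m::nat) (L :: nat \<Rightarrow> 'a set) (k :: nat \<Rightarrow> nat).
        1 \<le> m \<and>
        disjoint_family_on L {1..m} \<and> (\<forall>i\<in>{1..m}. L i \<noteq> {}) \<and> (\<Union>i\<in>{1..m}. L i) = P \<and>
        (\<forall>i\<in>{1..m}. 0 < k i) \<and>
        strict_mono_on {1..<m} k \<and> (1 < m \<longrightarrow> k (m - 1) \<le> k m) \<and>
        W = {X. X \<subseteq> P \<and> (\<forall>i\<in>{1..m}. k i \<le> card (X \<inter> (\<Union>j\<in>{1..i}. L j)))})"

definition desirability :: "'a set \<Rightarrow> 'a set set \<Rightarrow> ('a \<times> 'a) set" where
  "desirability P W =
     {(i, j). i \<in> P \<and> j \<in> P \<and>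
        (\<forall>X. X \<subseteq> P \<and> i \<notin> X \<and> j \<notin> X \<and> X \<union> {j} \<in> W \<longrightarrow> X \<union> {i} \<in> W)}"

definition complete_game :: "'a set \<Rightarrow> 'a set set \<Rightarrow> bool" where
  "complete_game P W \<longleftrightarrow>
     preorder_on P (desirability P W) \<and> total_on P (desirability P W)"

definition player_equivalence :: "'a set \<Rightarrow> 'a set set \<Rightarrow> ('a \<times> 'a) set" where
  "player_equivalence P W = desirability P W \<inter> (desirability P W)\<inverse>"

text \<open>\<open>C 1, \<dots>, C m\<close> lists the equivalence classes in order of strictly decreasing
  desirability.  For a complete game such an enumeration exists, and \<open>m\<close> and the values of \<open>C\<close>
  on \<open>{1..m}\<close> are uniquely determined; values of \<open>C\<close> elsewhere are never used.\<close>

definition class_numbering ::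
    "'a set \<Rightarrow> 'a set set \<Rightarrow> nat \<Rightarrow> (nat \<Rightarrow> 'a set) \<Rightarrow> bool" where
  "class_numbering P W m C \<longleftrightarrow>
     bij_betw C {1..m} (P // player_equivalence P W) \<and>
     (\<forall>i\<in>{1..m}. \<forall>j\<in>{1..m}. i < j \<longrightarrow>
        (\<forall>p\<in>C i. \<forall>q\<in>C j. (p, q) \<in> desirability P W \<and> (q, p) \<notin> desirability P W))"

text \<open>A game on a multiset is given by the multiset \<open>N\<close> of all players and the set \<open>V\<close> of its
  winning submultisets.\<close>

definition class_mset :: "nat \<Rightarrow> (nat \<Rightarrow> 'a set) \<Rightarrow> nat multiset" where
  "class_mset m C = (\<Sum>i\<in>{1..m}. replicate_mset (card (C i)) i)"

definition canonical_winning ::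
    "'a set set \<Rightarrow> nat \<Rightarrow> (nat \<Rightarrow> 'a set) \<Rightarrow> nat multiset set" where
  "canonical_winning W m C =
     {A. A \<subseteq># class_mset m C \<and> (\<exists>X\<in>W. \<forall>i\<in>{1..m}. card (X \<inter> C i) = count A i)}"

definition is_shift :: "nat multiset \<Rightarrow> nat multiset \<Rightarrow> nat multiset \<Rightarrow> bool" where
  "is_shift N A A' \<longleftrightarrow>
     (\<exists>i j. i < j \<and> 1 \<le> count A i \<and> count A j < count N j \<and> A' = A - {#i#} + {#j#})"

definition shift_minimal_winning ::
    "nat multiset \<Rightarrow> nat multiset set \<Rightarrow> nat multiset \<Rightarrow> bool" where
  "shift_minimal_winning N V A \<longleftrightarrow>
     A \<in> V \<and> (\<forall>B. B \<subset># A \<longrightarrow> B \<notin> V) \<and> (\<forall>B. is_shift N A B \<longrightarrow> B \<notin> V)"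

end

theory Submission
  imports Defs "HOL-Library.Infinite_Set"
begin

text \<open>Say that a multiset \<open>A\<close> dominates \<open>M\<close> if for every \<open>s\<close> it has at least as many elements
  \<open>\<le> s\<close>.  Removing an element or shifting goes down in this order, and conversely one can descend from
  \<open>A\<close> to any multiset below it by such steps.  As the winning multisets of a complete game
  are upward closed, there is a unique shift-minimal one iff there is a least winning one.
  A least winning multiset yields thresholds, namely its numbers of elements \<open>\<le> s\<close>;
  they increase strictly because consecutive classes are inequivalent.  Conversely, in a hierarchical
  game levels may merge into a single equivalence class.  Rearranging a coalition inside
  each class so that it prefers the lower levels turns every threshold condition into lower bounds on
  the numbers of players in initial unions of classes, so the pointwise minimum of these numbers over all
  winning coalitions is attained by a winning coalition.\<close>

section \<open>Prefix counts and the dominance order on multisets\<close>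

definition prefix_count :: "nat multiset \<Rightarrow> nat \<Rightarrow> nat" where
  "prefix_count A s = size (filter_mset (\<lambda>x. x \<le> s) A)"

lemma prefix_count_0: "prefix_count A 0 = count A 0"
  unfolding prefix_count_def by (induction A) auto

lemma prefix_count_Suc: "prefix_count A (Suc s) = prefix_count A s + count A (Suc s)"
  unfolding prefix_count_def by (induction A) auto

lemma prefix_count_add: "prefix_count (A + B) s = prefix_count A s + prefix_count B s"
  by (simp add: prefix_count_def)

lemma prefix_count_single: "prefix_count {#i#} s = (if i \<le> s then 1 else 0)"
  by (simp add: prefix_count_def)

lemma prefix_count_mono: "A \<subseteq># B \<Longrightarrow> prefix_count A s \<le> prefix_count B s"
  unfolding prefix_count_def by (intro size_mset_mono multiset_filter_mono)

lemma prefix_count_shift_le: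
  assumes "is_shift N A B"
  shows "prefix_count B s \<le> prefix_count A s"
proof -
  obtain i j where ij: "i < j" "i \<in># A" "B = A - {#i#} + {#j#}"
    using assms by (auto simp: is_shift_def)
  obtain R where "A = add_mset i R" using ij(2) by (metis insert_DiffM)
  then show ?thesis using ij(1,3) by (simp add: prefix_count_def)
qed

text \<open>Each multiplicity is a difference of consecutive prefix counts, so dominance is
  antisymmetric.\<close>

lemma prefix_count_inject:
  assumes "\<And>s. prefix_count A s = prefix_count B s"
  shows "A = B"
proof (rule multiset_eqI)
  fix s show "count A s = count B s"
  proof (cases s)
    case 0
    then show ?thesis using assms[of 0] by (simp add: prefix_count_0)
  next
    case (Suc t)
    then show ?thesis using assms[of t] assms[of s] by (simp add: prefix_count_Suc)
  qed
qed

text \<open>Just before the first strict inequality the counts agree, so the excess of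
  \<open>A\<close> at \<open>i\<close> comes from copies of \<open>i\<close> itself; thus
  \<open>A\<close> has a copy of \<open>i\<close> to give up.\<close>

lemma first_prefix_difference:
  assumes le: "\<And>s. prefix_count M s \<le> prefix_count A s" and "A \<noteq> M"
  obtains i where "prefix_count M i < prefix_count A i" "count M i < count A i"
    "\<And>s. s < i \<Longrightarrow> prefix_count A s = prefix_count M s"
proof -
  have ex: "\<exists>i. prefix_count M i < prefix_count A i"
    using prefix_count_inject[of A M] le assms(2) by (metis le_neq_implies_less)
  define i where "i = (LEAST i. prefix_count M i < prefix_count A i)"
  have 1: "prefix_count M i < prefix_count A i" unfolding i_def using ex by (rule LeastI_ex)
  have 2: "prefix_count A s = prefix_count M s" if "s < i" for s
    using not_less_Least[of s] that le[of s] unfolding i_def by fastforce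
  have "count M i < count A i"
    using 1 2[of "i - 1"] by (cases i) (auto simp: prefix_count_0 prefix_count_Suc)
  with 1 2 that show ?thesis by blast
qed

text \<open>If \<open>i\<close> is the first index at which the prefix counts differ, then an element \<open>i\<close> of \<open>A\<close> is
  shifted to the next index \<open>j\<close> at which they agree again, or removed if there is none.\<close>

lemma dominance_step:
  assumes AN: "A \<subseteq># N" and MN: "M \<subseteq># N" and ne: "A \<noteq> M"
    and le: "\<And>s. prefix_count M s \<le> prefix_count A s"
  obtains A' where "A' \<subseteq># N" "A' \<subset># A \<or> is_shift N A A'"
    "\<And>s. prefix_count M s \<le> prefix_count A' s"
proof -
  obtain i where i: "prefix_count M i < prefix_count A i" "count M i < count A i"
    "\<And>s. s < i \<Longrightarrow> prefix_count A s = prefix_count M s"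
    using first_prefix_difference[OF le ne] by metis
  have iA: "i \<in># A" using i(2) by (simp flip: count_greater_zero_iff)
  define R where "R = A - {#i#}"
  have A: "A = R + {#i#}" using iA by (simp add: R_def)
  have RA: "R \<subset># A" unfolding A by simp
  have pA: "prefix_count A s = prefix_count R s + (if i \<le> s then 1 else 0)" for s
    by (simp only: A prefix_count_add prefix_count_single)
  show ?thesis
  proof (cases "\<exists>j>i. prefix_count A j = prefix_count M j")
    case False
    have "prefix_count M s \<le> prefix_count R s" for s
    proof (cases "i \<le> s")
      case True
      have "prefix_count M s \<noteq> prefix_count A s"
        using False i(1) True by (metis le_neq_implies_less less_irrefl)
      then show ?thesis using le[of s] pA[of s] True by simp
    qed (use le[of s] pA[of s] in simp)
    moreover have "R \<subseteq># N" using RA AN by (meson subset_mset.less_imp_le subset_mset.trans)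
    ultimately show ?thesis using that RA by blast
  next
    case True
    define j where "j = (LEAST j. i < j \<and> prefix_count A j = prefix_count M j)"
    have j: "i < j" "prefix_count A j = prefix_count M j"
      using LeastI_ex[OF True] unfolding j_def by auto
    have jmin: "prefix_count M s < prefix_count A s" if "i \<le> s" "s < j" for s
    proof (cases "i = s")
      case False
      then have "prefix_count A s \<noteq> prefix_count M s"
        using not_less_Least[of s] that unfolding j_def by fastforce
      then show ?thesis using le[of s] by simp
    qed (use i in simp)
    \<comment> \<open>From \<open>t\<close> to \<open>j\<close> the lead of \<open>A\<close>
      vanishes, so \<open>M\<close> has more copies of \<open>j\<close> than \<open>A\<close>; as
      \<open>M\<close> fits into \<open>N\<close>, there is room for one more
      \<open>j\<close>.\<close>
    obtain t where t: "j = Suc t" using j(1) by (cases j) auto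
    have "count A j < count M j"
      using jmin[of t] j t by (simp add: prefix_count_Suc)
    also have "\<dots> \<le> count N j" using MN by (simp add: mset_subset_eq_count)
    finally have cj: "count A j < count N j" .
    let ?A' = "R + {#j#}"
    have sh: "is_shift N A ?A'"
      unfolding is_shift_def R_def using j(1) iA cj by (intro exI[of _ i] exI[of _ j]) auto
    have "?A' \<subseteq># N"
    proof (rule mset_subset_eqI)
      fix x
      have "count R x \<le> count N x"
        using RA AN by (meson mset_subset_eq_count subset_mset.less_imp_le subset_mset.trans)
      moreover have "count R j < count N j" using cj A by (simp split: if_splits)
      ultimately show "count ?A' x \<le> count N x" by auto
    qed
    \<comment> \<open>The shift lowers the count only for \<open>i \<le> s < j\<close>, where
      \<open>A\<close> is strictly ahead by the choice of \<open>j\<close>.\<close>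
    moreover have "prefix_count M s \<le> prefix_count ?A' s" for s
      using le[of s] pA[of s] jmin[of s]
      unfolding prefix_count_add prefix_count_single by (auto split: if_splits)
    ultimately show ?thesis using that sh by blast
  qed
qed

text \<open>The weight \<open>\<Sum>x\<in>#A. Suc b - x\<close> serves as termination measure for removals and shifts.\<close>

lemma sum_mset_shift_less:
  fixes N :: "nat multiset"
  assumes "is_shift N A B" and "\<And>x. x \<in># N \<Longrightarrow> x \<le> b"
  shows "(\<Sum>x\<in>#B. Suc b - x) < (\<Sum>x\<in>#A. Suc b - x)"
proof -
  obtain i j where ij: "i < j" "i \<in># A" "count A j < count N j" "B = A - {#i#} + {#j#}"
    using assms(1) by (auto simp: is_shift_def)
  have "j \<in># N" using ij(3) by (simp flip: count_greater_zero_iff)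
  then have "j \<le> b" using assms(2) by blast
  have A: "A = (A - {#i#}) + {#i#}" using ij(2) by simp
  show ?thesis unfolding ij(4) by (subst (2) A) (use ij(1) \<open>j \<le> b\<close> in simp)
qed

text \<open>The \<open>Suc\<close> gives every element, even \<open>b\<close>, a positive weight, so
  each removal counts.\<close>

lemma sum_mset_subset_less:
  fixes N :: "nat multiset"
  assumes "B \<subset># A" "A \<subseteq># N" and "\<And>x. x \<in># N \<Longrightarrow> x \<le> b"
  shows "(\<Sum>x\<in>#B. Suc b - x) < (\<Sum>x\<in>#A. Suc b - x)"
proof -
  obtain C where C: "A = B + C" "C \<noteq> {#}"
    using assms(1) by (metis subset_mset.less_imp_le subset_mset.le_iff_add add_cancel_left_right
        subset_mset.less_irrefl)
  then obtain x where x: "x \<in># C" by blast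
  then have "x \<le> b" using C assms(2,3) by (metis mset_subset_eqD mset_subset_eq_add_right)
  obtain D where "C = add_mset x D" using x by (metis insert_DiffM)
  then show ?thesis using C \<open>x \<le> b\<close> by simp
qed

section \<open>Shift-minimal and least winning multisets\<close>

text \<open>A winning multiset that is not shift-minimal has a winning proper submultiset or a
  winning shift; either is lower in dominance and has smaller weight, so the descent ends.\<close>

lemma shift_minimal_below:
  assumes V: "\<And>A. A \<in> V \<Longrightarrow> A \<subseteq># N" and "B \<in> V"
  obtains A where "shift_minimal_winning N V A" "\<And>s. prefix_count A s \<le> prefix_count B s"
proof -
  \<comment> \<open>For empty \<open>N\<close> the value of \<open>Max\<close> is unspecified, but
    the bound is then vacuous.\<close>
  define b where "b = Max (set_mset N)"
  have b: "x \<le> b" if "x \<in># N" for x using that by (simp add: b_def)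
  have "\<exists>A. shift_minimal_winning N V A \<and> (\<forall>s. prefix_count A s \<le> prefix_count B s)"
    using assms(2)
  proof (induction "\<Sum>x\<in>#B. Suc b - x" arbitrary: B rule: less_induct)
    case less
    show ?case
    proof (cases "shift_minimal_winning N V B")
      case False
      then obtain B' where B': "B' \<in> V" "B' \<subset># B \<or> is_shift N B B'"
        using less.prems by (auto simp: shift_minimal_winning_def)
      have "(\<Sum>x\<in>#B'. Suc b - x) < (\<Sum>x\<in>#B. Suc b - x)"
        using B'(2) sum_mset_shift_less[OF _ b] sum_mset_subset_less[OF _ V[OF less.prems] b] by blast
      then obtain A where "shift_minimal_winning N V A" "\<forall>s. prefix_count A s \<le> prefix_count B' s"
        using less.hyps B'(1) by blast
      moreover have "prefix_count B' s \<le> prefix_count B s" for s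
        using B'(2) prefix_count_shift_le prefix_count_mono[OF subset_mset.less_imp_le] by blast
      ultimately show ?thesis using order_trans by blast
    qed auto
  qed
  then show ?thesis using that by blast
qed

text \<open>If there is only one shift-minimal multiset, every descent ends there, so it is least.
  Conversely, a shift-minimal \<open>A\<close> other than the least \<open>M\<close> would admit a
  removal or shift that still dominates \<open>M\<close> and hence wins.\<close>

lemma unique_shift_minimal_iff_least:
  assumes V: "\<And>A. A \<in> V \<Longrightarrow> A \<subseteq># N" and "V \<noteq> {}"
    and up: "\<And>A B. A \<in> V \<Longrightarrow> B \<subseteq># N \<Longrightarrow> (\<And>s. prefix_count A s \<le> prefix_count B s) \<Longrightarrow> B \<in> V"
  shows "(\<exists>!A. shift_minimal_winning N V A) \<longleftrightarrow>
    (\<exists>M\<in>V. \<forall>A\<in>V. \<forall>s. prefix_count M s \<le> prefix_count A s)"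
proof
  assume "\<exists>!A. shift_minimal_winning N V A"
  then obtain M where M: "shift_minimal_winning N V M"
    and uni: "\<And>A. shift_minimal_winning N V A \<Longrightarrow> A = M" by blast
  have "prefix_count M s \<le> prefix_count A s" if "A \<in> V" for A s
    using shift_minimal_below[OF V that] uni by metis
  then show "\<exists>M\<in>V. \<forall>A\<in>V. \<forall>s. prefix_count M s \<le> prefix_count A s"
    using M by (auto simp: shift_minimal_winning_def)
next
  assume "\<exists>M\<in>V. \<forall>A\<in>V. \<forall>s. prefix_count M s \<le> prefix_count A s"
  then obtain M where M: "M \<in> V" and least: "\<And>A s. A \<in> V \<Longrightarrow> prefix_count M s \<le> prefix_count A s"
    by blast
  have uni: "A = M" if "shift_minimal_winning N V A" for A
  proof (rule ccontr)
    assume "A \<noteq> M"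
    have "A \<in> V" using that by (simp add: shift_minimal_winning_def)
    obtain A' where "A' \<subseteq># N" "A' \<subset># A \<or> is_shift N A A'"
      "\<And>s. prefix_count M s \<le> prefix_count A' s"
      using dominance_step[OF V[OF \<open>A \<in> V\<close>] V[OF M] \<open>A \<noteq> M\<close> least[OF \<open>A \<in> V\<close>]] by metis
    then show False using that up[OF M] by (auto simp: shift_minimal_winning_def)
  qed
  then show "\<exists>!A. shift_minimal_winning N V A"
    using shift_minimal_below[OF V M] by metis
qed

section \<open>Exchange arguments for desirability\<close>

lemma desirability_exchange:
  assumes "(i, j) \<in> desirability P W" "X \<in> W" "X \<subseteq> P" "j \<in> X" "i \<notin> X"
  shows "X - {j} \<union> {i} \<in> W"
proof -
  have "X - {j} \<union> {j} \<in> W" using assms(2,4) by (simp add: insert_absorb)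
  moreover have "\<forall>Y. Y \<subseteq> P \<and> i \<notin> Y \<and> j \<notin> Y \<and> Y \<union> {j} \<in> W \<longrightarrow> Y \<union> {i} \<in> W"
    using assms(1) by (simp add: desirability_def)
  ultimately show ?thesis using assms(3,5) by (simp add: subset_iff)
qed

lemma desirabilityI:
  assumes "i \<in> P" "j \<in> P"
    and "\<And>X. X \<subseteq> P \<Longrightarrow> i \<notin> X \<Longrightarrow> j \<notin> X \<Longrightarrow> X \<union> {j} \<in> W \<Longrightarrow> X \<union> {i} \<in> W"
  shows "(i, j) \<in> desirability P W"
  using assms unfolding desirability_def by blast

lemma trans_desirability: "trans (desirability P W)"
proof (rule transI)
  fix i j l assume ij: "(i, j) \<in> desirability P W" and jl: "(j, l) \<in> desirability P W"
  have P: "i \<in> P" "j \<in> P" "l \<in> P" using ij jl by (auto simp: desirability_def)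
  show "(i, l) \<in> desirability P W"
  proof (rule desirabilityI)
    fix X assume X: "X \<subseteq> P" "i \<notin> X" "l \<notin> X" "X \<union> {l} \<in> W"
    show "X \<union> {i} \<in> W"
    proof (cases "i = l \<or> j = l \<or> i = j")
      case False
      show ?thesis
      proof (cases "j \<in> X")
        case True
        \<comment> \<open>With the middle player \<open>j\<close> already in \<open>X\<close>, first
          \<open>j\<close> is traded for \<open>i\<close> and then \<open>l\<close> for
          \<open>j\<close>.\<close>
        have "(X \<union> {l}) - {j} \<union> {i} \<in> W"
          by (rule desirability_exchange[OF ij]) (use X P False True in auto)
        from desirability_exchange[OF jl this]
        have "(X \<union> {l}) - {j} \<union> {i} - {l} \<union> {j} \<in> W" using X P False by auto
        also have "(X \<union> {l}) - {j} \<union> {i} - {l} \<union> {j} = X \<union> {i}" using True False X by auto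
        finally show ?thesis .
      next
        case notin: False
        have "X \<union> {j} \<in> W" using jl X notin by (auto simp: desirability_def)
        then show ?thesis using ij X notin by (auto simp: desirability_def)
      qed
    qed (use X ij jl in \<open>auto simp: desirability_def\<close>)
  qed (use P in auto)
qed

section \<open>Games whose desirability relation is given by a rank function\<close>

text \<open>Smaller ranks mean more desirable players, as in the numbering of the classes. The range
  \<open>{1..m}\<close> is imposed only where class numbers matter.\<close>

locale ranked_game =
  fixes P :: "'a set" and W :: "'a set set" and r :: "'a \<Rightarrow> nat"
  assumes game: "simple_game P W"
    and rank: "\<And>p q. p \<in> P \<Longrightarrow> q \<in> P \<Longrightarrow> (p, q) \<in> desirability P W \<longleftrightarrow> r p \<le> r q"
begin

lemma finite_P: "finite P"
  and winning_subset: "X \<in> W \<Longrightarrow> X \<subseteq> P"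
  and winning_mono: "X \<in> W \<Longrightarrow> X \<subseteq> Y \<Longrightarrow> Y \<subseteq> P \<Longrightarrow> Y \<in> W"
  and winning_nonempty: "W \<noteq> {}"
  using game by (auto simp: simple_game_def)

lemma finite_coalition: "X \<subseteq> P \<Longrightarrow> finite X"
  using finite_P finite_subset by blast

definition profile :: "'a set \<Rightarrow> nat multiset" where
  "profile X = image_mset r (mset_set X)"

definition above :: "'a set \<Rightarrow> nat \<Rightarrow> 'a set" where
  "above X s = {x \<in> X. r x \<le> s}"

lemma prefix_count_profile:
  assumes "X \<subseteq> P"
  shows "prefix_count (profile X) s = card (above X s)"
  using finite_coalition[OF assms]
  by (simp add: prefix_count_def profile_def above_def filter_mset_image_mset)

lemma finite_above: "X \<subseteq> P \<Longrightarrow> finite (above X s)"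
  using finite_coalition by (auto simp: above_def)

text \<open>Members of \<open>X - Y\<close> are traded one at a time for players of
  \<open>Y - X\<close> that are at least as desirable; the coalition stays winning and dominated by
  \<open>Y\<close> until it lies inside \<open>Y\<close>.\<close>

lemma winning_dominance:
  assumes "X \<in> W" "Y \<subseteq> P" and "\<And>s. card (above X s) \<le> card (above Y s)"
  shows "Y \<in> W"
  using assms(1,3)
proof (induction "card (X - Y)" arbitrary: X rule: less_induct)
  case less
  note XP = winning_subset[OF less.prems(1)]
  show ?case
  proof (cases "X \<subseteq> Y")
    case True
    then show ?thesis using winning_mono less.prems assms(2) by blast
  next
    case False
    then obtain w where "w \<in> X - Y" by blast
    then obtain x where x: "x \<in> X - Y" and xmin: "\<And>z. z \<in> X - Y \<Longrightarrow> r x \<le> r z"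
      using ex_has_least_nat[of "\<lambda>x. x \<in> X - Y" w r] by blast
    \<comment> \<open>If \<open>Y\<close> had no player of rank at most \<open>r x\<close> outside
      \<open>X\<close>, then \<open>x\<close> would make the count of \<open>X\<close> at
      \<open>r x\<close> exceed that of \<open>Y\<close>.\<close>
    have "\<not> above Y (r x) \<subseteq> above X (r x)"
    proof
      assume "above Y (r x) \<subseteq> above X (r x)"
      then have "above Y (r x) \<subset> above X (r x)" using x by (auto simp: above_def)
      then show False
        using psubset_card_mono[OF finite_above[OF XP]] less.prems(2)[of "r x"] leD by blast
    qed
    then obtain y where y: "y \<in> Y" "y \<notin> X" "r y \<le> r x" by (auto simp: above_def)
    let ?X' = "X - {x} \<union> {y}"
    have "?X' \<in> W"
      using desirability_exchange[of y x] less.prems(1) XP rank x y assms(2) by blast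
    \<comment> \<open>The trade raises a count only for \<open>r y \<le> s < r x\<close>; there
      every counted player is \<open>y\<close> or, by minimality of \<open>x\<close>, belongs to
      \<open>Y\<close>.\<close>
    moreover have "card (above ?X' s) \<le> card (above Y s)" for s
    proof (cases "r y \<le> s \<and> s < r x")
      case True
      have "above ?X' s \<subseteq> above Y s"
      proof
        fix z assume "z \<in> above ?X' s"
        then have "z = y \<or> z \<in> X" "r z \<le> s" by (auto simp: above_def)
        then show "z \<in> above Y s" using y(1) xmin[of z] True by (auto simp: above_def)
      qed
      then show ?thesis by (rule card_mono[OF finite_above[OF assms(2)]])
    next
      case False
      have "card (above ?X' s) = card (above X s)"
      proof (cases "r x \<le> s")
        case True
        then have "above ?X' s = insert y (above X s - {x})" "x \<in> above X s" "y \<notin> above X s"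
          using x y by (auto simp: above_def)
        then show ?thesis
          using card_Suc_Diff1[OF finite_above[OF XP, of s], of x] finite_above[OF XP, of s] by simp
      next
        case F: False
        then have "above ?X' s = above X s" using False x y by (auto simp: above_def)
        then show ?thesis by simp
      qed
      then show ?thesis using less.prems(2) by simp
    qed
    moreover have "card (?X' - Y) < card (X - Y)"
      by (rule psubset_card_mono) (use x y finite_coalition[OF XP] in auto)
    ultimately show ?thesis using less.hyps by blast
  qed
qed

section \<open>Profiles and the canonical representation\<close>

lemma profile_subset_mset: "X \<subseteq> P \<Longrightarrow> profile X \<subseteq># profile P"
  unfolding profile_def by (intro image_mset_subseteq_mono) (simp add: finite_P finite_coalition)

text \<open>A submultiset of an image lifts to a submultiset \<open>A'\<close> of
  \<open>mset_set P\<close>; its multiplicities are at most one, so it is a set of players.\<close>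

lemma profile_realization:
  assumes "A \<subseteq># profile P"
  obtains X where "X \<subseteq> P" "profile X = A"
proof -
  obtain B where "image_mset r (mset_set P) = A + B"
    using assms unfolding profile_def by (metis subset_mset.le_iff_add)
  then obtain A' B' where AB: "mset_set P = A' + B'" "A = image_mset r A'"
    by (metis image_mset_eq_plusD)
  then have "A' \<subseteq># mset_set P" by simp
  then have "count A' x \<le> count (mset_set P) x" for x by (simp add: mset_subset_eq_count)
  moreover have "count (mset_set P) x \<le> 1" for x by (simp add: count_mset_set')
  ultimately have "count A' x \<le> 1" for x using order_trans by blast
  then have "count (mset_set (set_mset A')) x = count A' x" for x
    using count_greater_zero_iff[of A' x]
    by (auto simp: count_mset_set' not_in_iff intro!: le_antisym)
  then have "mset_set (set_mset A') = A'" by (rule multiset_eqI)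
  moreover have "set_mset A' \<subseteq> P"
    using \<open>A' \<subseteq># mset_set P\<close> finite_P by (metis finite_set_mset_mset_set set_mset_mono)
  ultimately show ?thesis using that[of "set_mset A'"] AB(2) by (simp add: profile_def)
qed

lemma unique_shift_minimal_iff:
  "(\<exists>!A. shift_minimal_winning (profile P) (profile ` W) A) \<longleftrightarrow>
    (\<exists>M\<in>W. \<forall>X\<in>W. \<forall>s. card (above M s) \<le> card (above X s))"
proof -
  have "B \<in> profile ` W"
    if AB: "A \<in> profile ` W" "B \<subseteq># profile P" "\<And>s. prefix_count A s \<le> prefix_count B s" for A B
  proof -
    obtain X Y where "X \<in> W" "A = profile X" "Y \<subseteq> P" "profile Y = B"
      using AB(1,2) profile_realization by (metis imageE)
    then show ?thesis using AB(3) winning_dominance[of X Y] winning_subset prefix_count_profile by auto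
  qed
  then have "(\<exists>!A. shift_minimal_winning (profile P) (profile ` W) A) \<longleftrightarrow>
    (\<exists>M\<in>profile ` W. \<forall>A\<in>profile ` W. \<forall>s. prefix_count M s \<le> prefix_count A s)"
    by (intro unique_shift_minimal_iff_least)
      (auto simp: winning_nonempty winning_subset profile_subset_mset)
  then show ?thesis by (simp add: prefix_count_profile winning_subset)
qed

lemma count_profile: "X \<subseteq> P \<Longrightarrow> count (profile X) i = card {x \<in> X. r x = i}"
  unfolding profile_def count_conv_size_mset
  by (auto simp: filter_mset_image_mset finite_coalition intro: arg_cong[where f = card])

lemma canonical_representation:
  assumes range: "r ` P = {1..m}" and C: "\<And>i. i \<in> {1..m} \<Longrightarrow> C i = {p \<in> P. r p = i}"
  shows "class_mset m C = profile P" "canonical_winning W m C = profile ` W"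
proof -
  have none: "{x \<in> X. r x = i} = {}" if "X \<subseteq> P" "i \<notin> {1..m}" for X i
    using that range by blast
  show N: "class_mset m C = profile P"
  proof (rule multiset_eqI)
    fix i
    have "count (class_mset m C) i = (\<Sum>j\<in>{1..m}. if j = i then card (C j) else 0)"
      unfolding class_mset_def count_sum by (intro sum.cong) auto
    also have "\<dots> = (if i \<in> {1..m} then card (C i) else 0)" by (simp add: sum.delta)
    also have "\<dots> = count (profile P) i"
      using C[of i] none[OF order_refl, of i] by (cases "i \<in> {1..m}") (simp_all only: count_profile[OF order_refl] card.empty if_True if_False not_False_eq_True)
    finally show "count (class_mset m C) i = count (profile P) i" .
  qed
  have inter: "X \<inter> C i = {x \<in> X. r x = i}" if "X \<subseteq> P" "i \<in> {1..m}" for X i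
    using C[OF that(2)] that(1) by blast
  show "canonical_winning W m C = profile ` W"
  proof (intro equalityI subsetI)
    fix A assume "A \<in> canonical_winning W m C"
    then obtain X where A: "A \<subseteq># profile P" and X: "X \<in> W"
      and eq: "\<And>i. i \<in> {1..m} \<Longrightarrow> card (X \<inter> C i) = count A i"
      unfolding canonical_winning_def N by blast
    note XP = winning_subset[OF X]
    have "count A i = count (profile X) i" for i
    proof (cases "i \<in> {1..m}")
      \<comment> \<open>\<open>canonical_winning\<close> fixes multiplicities only on
        \<open>{1..m}\<close>; any other index is absent from \<open>profile P\<close>, hence from
        \<open>A\<close>.\<close>
      case False
      have "count A i \<le> count (profile P) i" using A by (rule mset_subset_eq_count)
      then show ?thesis
        using none[OF XP False] none[OF order_refl False]
        by (simp only: count_profile[OF XP] count_profile[OF order_refl] card.empty)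
    qed (use eq inter[OF XP] in \<open>simp add: count_profile[OF XP]\<close>)
    then have "A = profile X" by (rule multiset_eqI)
    then show "A \<in> profile ` W" using X by blast
  next
    fix A assume "A \<in> profile ` W"
    then obtain X where X: "X \<in> W" "A = profile X" by blast
    note XP = winning_subset[OF X(1)]
    have "\<forall>i\<in>{1..m}. card (X \<inter> C i) = count A i"
      using inter[OF XP] X(2) by (simp add: count_profile[OF XP])
    then show "A \<in> canonical_winning W m C"
      unfolding canonical_winning_def N using X profile_subset_mset[OF XP] by blast
  qed
qed

lemma class_numbering_of_rank:
  assumes range: "r ` P = {1..m}"
  shows "class_numbering P W m (\<lambda>i. {p \<in> P. r p = i})"
proof -
  let ?C = "\<lambda>i. {p \<in> P. r p = i}"
  have cls: "player_equivalence P W `` {p} = ?C (r p)" if "p \<in> P" for p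
  proof -
    have "player_equivalence P W `` {p} \<subseteq> P"
      by (auto simp: player_equivalence_def desirability_def)
    then show ?thesis
      using rank[OF that] rank[OF _ that] by (auto simp: player_equivalence_def)
  qed
  have "P // player_equivalence P W = (\<lambda>p. ?C (r p)) ` P"
    using cls by (auto simp: quotient_def)
  also have "\<dots> = ?C ` {1..m}" by (metis image_image range)
  finally have "P // player_equivalence P W = ?C ` {1..m}" .
  moreover have "inj_on ?C {1..m}"
  proof (rule inj_onI)
    fix i j assume i: "i \<in> {1..m}" and eq: "?C i = ?C j"
    obtain p where "p \<in> P" "r p = i" using i unfolding range[symmetric] by blast
    then show "i = j" using eq by blast
  qed
  ultimately show ?thesis using rank unfolding class_numbering_def bij_betw_def by simp
qed

section \<open>Thresholds from a least winning coalition\<close>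

text \<open>With the classes as levels and the prefix counts of \<open>M\<close> as thresholds,
  dominating \<open>M\<close> amounts to the threshold conditions.\<close>

lemma conjunctive_hierarchical_if_least:
  assumes ne: "{} \<notin> W" and range: "r ` P = {1..m}"
    and M: "M \<in> W" and least: "\<And>X s. X \<in> W \<Longrightarrow> card (above M s) \<le> card (above X s)"
  shows "conjunctive_hierarchical P W"
proof -
  define L where "L i = {p \<in> P. r p = i}" for i
  define k where "k i = card (above M i)" for i
  note MP = winning_subset[OF M]
  have rP: "1 \<le> r p" "r p \<le> m" if "p \<in> P" for p
    using range that by (metis atLeastAtMost_iff imageI)+
  have L_ne: "\<exists>p. p \<in> P \<and> r p = i" if "1 \<le> i" "i \<le> m" for i
    using range that by (metis (no_types) atLeastAtMost_iff imageE)
  have above_L: "X \<inter> (\<Union>j\<in>{1..i}. L j) = above X i" if "X \<subseteq> P" for X i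
    using that rP by (auto simp: above_def L_def)
  have W: "X \<in> W \<longleftrightarrow> X \<subseteq> P \<and> (\<forall>i\<in>{1..m}. k i \<le> card (above X i))" for X
  proof
    assume X: "X \<subseteq> P \<and> (\<forall>i\<in>{1..m}. k i \<le> card (above X i))"
    have "k s \<le> card (above X s)" for s
    proof -
      \<comment> \<open>Dominance concerns all \<open>s\<close>, the thresholds only
        \<open>1\<close> to \<open>m\<close>: at \<open>0\<close> the count of \<open>M\<close>
        vanishes, and beyond \<open>m\<close> nothing changes.\<close>
      consider "s = 0" | "s \<in> {1..m}" | "s > m" by force
      then show ?thesis
      proof cases
        case 1
        then have "above M s = {}" using MP rP by (fastforce simp: above_def)
        then show ?thesis by (simp add: k_def)
      next
        case 3
        then have s: "above Y s = above Y m" if "Y \<subseteq> P" for Y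
          using that rP(2) by (fastforce simp: above_def)
        have "k m \<le> card (above X m)"
        proof (cases "m = 0")
          case True
          then have "M = {}" using MP rP by fastforce
          then show ?thesis using M ne by simp
        qed (use X in auto)
        then show ?thesis using s X MP by (simp add: k_def)
      qed (use X in blast)
    qed
    then show "X \<in> W" using winning_dominance[OF M] X by (simp add: k_def)
  qed (use winning_subset least in \<open>auto simp: k_def\<close>)
  \<comment> \<open>Otherwise the condition at \<open>Suc i\<close> would follow from the one at
    \<open>i\<close>, and classes \<open>Suc i\<close> and \<open>Suc (Suc i)\<close> would be
    interchangeable. The argument needs a class after \<open>Suc i\<close>, so it gives nothing
    strict at \<open>m\<close>. The case \<open>i = 0\<close> makes the first threshold positive
    when \<open>1 < m\<close>.\<close>
  have k_Suc: "k i < k (Suc i)" if im: "Suc i < m" for i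
  proof (rule ccontr)
    assume neg: "\<not> k i < k (Suc i)"
    obtain p q where p: "p \<in> P" "r p = Suc i" and q: "q \<in> P" "r q = Suc (Suc i)"
      using L_ne[of "Suc i"] L_ne[of "Suc (Suc i)"] im by auto
    have "(q, p) \<in> desirability P W"
    proof (rule desirabilityI)
      fix X assume X: "X \<subseteq> P" "q \<notin> X" "p \<notin> X" "X \<union> {p} \<in> W"
      have "k t \<le> card (above (X \<union> {q}) t)" if "t \<in> {1..m}" for t
      proof -
        have old: "k t \<le> card (above (X \<union> {p}) t)" for t
          using X(4) least by (simp add: k_def)
        have "t < Suc i \<or> t = Suc i \<or> t > Suc i" by arith
        then consider "t < Suc i" | "t = Suc i" | "t > Suc i" by blast
        then show ?thesis
        proof cases
          case 1
          then have "above (X \<union> {q}) t = above (X \<union> {p}) t" using p q by (auto simp: above_def)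
          then show ?thesis using old by simp
        next
          case 2
          \<comment> \<open>Only the condition at \<open>Suc i\<close> can suffer when
            \<open>q\<close> replaces \<open>p\<close>; it is bounded through index
            \<open>i\<close>, where \<open>p\<close> is not counted.\<close>
          have "k t \<le> card (above (X \<union> {p}) i)" using neg 2 old[of i] by simp
          also have "\<dots> \<le> card (above (X \<union> {q}) t)"
            by (intro card_mono finite_above) (use X q p 2 in \<open>auto simp: above_def\<close>)
          finally show ?thesis .
        next
          case 3
          then have "above (X \<union> {q}) t = insert q (above X t)"
            "above (X \<union> {p}) t = insert p (above X t)" using p q by (auto simp: above_def)
          moreover have "q \<notin> above X t" "p \<notin> above X t" using X by (auto simp: above_def)
          ultimately show ?thesis using old[of t] finite_above[OF X(1)] by simp
        qed
      qed
      then show "X \<union> {q} \<in> W" using W X q by blast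
    qed (use p q in auto)
    then show False using rank p q by simp
  qed
  have k_mono: "k i \<le> k j" if "i \<le> j" for i j
    unfolding k_def
    by (intro card_mono finite_above MP) (use that in \<open>auto simp: above_def\<close>)
  have m: "1 \<le> m"
    using M MP ne rP by (metis equals0I le_trans subsetD)
  have "0 < k m"
  proof -
    have "above M m = M" using MP rP by (auto simp: above_def)
    then show ?thesis using M ne finite_coalition[OF MP] by (auto simp: k_def card_gt_0_iff)
  qed
  have k_pos: "0 < k i" if "i \<in> {1..m}" for i
  proof (cases "i = m")
    case False
    then show ?thesis using k_Suc[of "i - 1"] that by simp
  qed (use \<open>0 < k m\<close> in simp)
  show ?thesis unfolding conjunctive_hierarchical_def
  proof (intro exI conjI)
    show "1 \<le> m" by (rule m)
    show "disjoint_family_on L {1..m}"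
      by (auto simp: disjoint_family_on_def L_def)
    show "\<forall>i\<in>{1..m}. L i \<noteq> {}" using L_ne by (fastforce simp: L_def)
    show "(\<Union>i\<in>{1..m}. L i) = P" using rP by (auto simp: L_def)
    show "\<forall>i\<in>{1..m}. 0 < k i" using k_pos by blast
    show "strict_mono_on {1..<m} k"
    proof (rule strict_mono_onI)
      fix i j assume ij: "i \<in> {1..<m}" "j \<in> {1..<m}" "i < j"
      have "k i \<le> k (j - 1)" using ij by (intro k_mono) simp
      also have "\<dots> < k j" using k_Suc[of "j - 1"] ij by simp
      finally show "k i < k j" .
    qed
    show "1 < m \<longrightarrow> k (m - 1) \<le> k m" using k_mono[of "m - 1" m] by simp
    show "W = {X. X \<subseteq> P \<and> (\<forall>i\<in>{1..m}. k i \<le> card (X \<inter> (\<Union>j\<in>{1..i}. L j)))}"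
    proof (rule set_eqI)
      fix X show "X \<in> W \<longleftrightarrow>
        X \<in> {X. X \<subseteq> P \<and> (\<forall>i\<in>{1..m}. k i \<le> card (X \<inter> (\<Union>j\<in>{1..i}. L j)))}"
        unfolding W mem_Collect_eq using above_L[of X] by (cases "X \<subseteq> P") simp_all
    qed
  qed
qed

section \<open>A coalition attaining all least prefix counts\<close>

text \<open>The minimum is taken for each \<open>s\<close> separately, so different \<open>s\<close>
  may call for different winning coalitions.\<close>

definition "least_above s = (LEAST n. \<exists>X\<in>W. card (above X s) = n)"

lemma least_above_attained: "\<exists>X\<in>W. card (above X s) = least_above s"
  unfolding least_above_def by (rule LeastI_ex) (use winning_nonempty in blast)

lemma least_above_le: "X \<in> W \<Longrightarrow> least_above s \<le> card (above X s)"
  unfolding least_above_def by (rule Least_le) blast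

lemma least_above_mono: "least_above s \<le> least_above (Suc s)"
proof -
  obtain X where X: "X \<in> W" "card (above X (Suc s)) = least_above (Suc s)"
    using least_above_attained by blast
  have "card (above X s) \<le> card (above X (Suc s))"
    by (intro card_mono finite_above winning_subset X) (auto simp: above_def)
  then show ?thesis using least_above_le[OF X(1), of s] X(2) by simp
qed

lemma least_above_0: "least_above 0 \<le> card {p \<in> P. r p = 0}"
proof -
  have "card (above P 0) = card {p \<in> P. r p = 0}" by (simp add: above_def)
  moreover have "P \<in> W" using winning_nonempty winning_subset winning_mono by blast
  ultimately show ?thesis using least_above_le by metis
qed

lemma least_above_Suc: "least_above (Suc s) \<le> least_above s + card {p \<in> P. r p = Suc s}"
proof -
  obtain X where X: "X \<in> W" "card (above X s) = least_above s"
    using least_above_attained by blast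
  have "above X (Suc s) \<subseteq> above X s \<union> {p \<in> P. r p = Suc s}"
    using winning_subset[OF X(1)] by (auto simp: above_def le_Suc_eq)
  then have "card (above X (Suc s)) \<le> card (above X s \<union> {p \<in> P. r p = Suc s})"
    by (intro card_mono) (auto simp: finite_P finite_above winning_subset X)
  also have "\<dots> \<le> card (above X s) + card {p \<in> P. r p = Suc s}" by (rule card_Un_le)
  finally show ?thesis using least_above_le[OF X(1), of "Suc s"] X(2) by simp
qed

text \<open>From each class as many players are taken as the minimum grows there; this growth is
  nonnegative and at most the class size. Whether the resulting coalition wins is a separate
  question.\<close>

lemma least_above_realization:
  obtains M where "M \<subseteq> P" "\<And>s. card (above M s) = least_above s"
proof -
  define d where "d s = (case s of 0 \<Rightarrow> least_above 0 | Suc t \<Rightarrow> least_above s - least_above t)" for s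
  have d_le: "d s \<le> card {p \<in> P. r p = s}" for s
    using least_above_0 least_above_Suc by (auto simp: d_def le_diff_conv add.commute split: nat.split)
  have ex: "\<exists>D. D \<subseteq> {p \<in> P. r p = s} \<and> card D = d s" for s
    by (rule obtain_subset_with_card_n[OF d_le[of s]]) blast
  define D where "D s = (SOME D. D \<subseteq> {p \<in> P. r p = s} \<and> card D = d s)" for s
  have D: "D s \<subseteq> {p \<in> P. r p = s}" "card (D s) = d s" for s
    using someI_ex[OF ex[of s]] unfolding D_def by blast+
  define M where "M = {p \<in> P. p \<in> D (r p)}"
  have MP: "M \<subseteq> P" by (auto simp: M_def)
  have fin: "finite (D s)" for s using D(1)[of s] finite_P by (simp add: finite_subset)
  have "card (above M s) = least_above s" for s
  proof (induction s)
    case 0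
    have "above M 0 = D 0" using D(1)[of 0] by (auto simp: above_def M_def)
    then show ?case using D(2)[of 0] by (simp add: d_def)
  next
    case (Suc s)
    have "above M (Suc s) = above M s \<union> D (Suc s)"
      using D(1)[of "Suc s"] by (auto simp: above_def M_def le_Suc_eq)
    moreover have "above M s \<inter> D (Suc s) = {}"
      using D(1)[of "Suc s"] by (auto simp: above_def M_def)
    ultimately have "card (above M (Suc s)) = card (above M s) + d (Suc s)"
      using card_Un_disjoint[of "above M s" "D (Suc s)"] D(2) fin finite_above[OF MP] by metis
    then show ?case using Suc least_above_mono[of s] by (simp add: d_def)
  qed
  with MP show ?thesis using that by blast
qed

text \<open>For use when a threshold condition cuts through a class, so that only strictly smaller
  ranks are compared. At \<open>s = 0\<close> no rank lies below, and any winning coalition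
  serves.\<close>

lemma card_below_ge:
  assumes "X \<subseteq> P" "\<And>s. least_above s \<le> card (above X s)"
  obtains Y where "Y \<in> W" "card {x \<in> Y. r x < s} \<le> card {x \<in> X. r x < s}"
proof (cases s)
  case 0
  then show ?thesis using that winning_nonempty by auto
next
  case (Suc t)
  then have "{x \<in> Z. r x < s} = above Z t" for Z by (auto simp: above_def)
  then show ?thesis using that least_above_attained[of t] assms(2)[of t] by auto
qed

section \<open>Least winning coalitions in games given by levels\<close>

lemma winning_if_least_above_le:
  fixes f :: "'a \<Rightarrow> nat"
  assumes W: "W = {X. X \<subseteq> P \<and> (\<forall>i\<in>I. k i \<le> card {x \<in> X. f x \<le> i})}"
    and I: "I \<subseteq> f ` P"
    and refine: "\<And>p q. p \<in> P \<Longrightarrow> q \<in> P \<Longrightarrow> f p \<le> f q \<Longrightarrow> r p \<le> r q"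
    and "X \<subseteq> P" "\<And>s. least_above s \<le> card (above X s)"
  shows "X \<in> W"
  using assms(4,5)
proof (induction "sum f X" arbitrary: X rule: less_induct)
  case less
  txt \<open>The induction first makes \<open>X\<close> packed, i.e. within each class \<open>X\<close> prefers the
    players of lower level; then, in the class of a player of level \<open>i\<close>, either all members of \<open>X\<close>
    have level at most \<open>i\<close> or \<open>X\<close> contains all players of level at most \<open>i\<close>.\<close>
  note XP = less.prems(1)
  note fin = finite_coalition[OF XP]
  show ?case
  proof (cases "\<exists>x\<in>X. \<exists>y\<in>P - X. r x = r y \<and> f y < f x")
    case True
    then obtain x y where xy: "x \<in> X" "y \<in> P" "y \<notin> X" "r x = r y" "f y < f x" by blast
    let ?X' = "X - {x} \<union> {y}"
    have "card (above ?X' s) = card (above X s)" for s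
    proof (cases "r x \<le> s")
      case True
      then have "above ?X' s = insert y (above X s - {x})" "x \<in> above X s" "y \<notin> above X s"
        using xy by (auto simp: above_def)
      then show ?thesis
        using card_Suc_Diff1[OF finite_above[OF XP, of s], of x] finite_above[OF XP, of s] by simp
    next
      case F: False
      then have "above ?X' s = above X s" using xy by (auto simp: above_def)
      then show ?thesis by simp
    qed
    moreover have "sum f ?X' < sum f X"
      using fin xy sum.remove[OF fin xy(1), of f] by simp
    ultimately have "?X' \<in> W" using less.hyps[of ?X'] less.prems xy by auto
    \<comment> \<open>The induction hypothesis makes \<open>?X'\<close> winning; as \<open>x\<close>
      and \<open>y\<close> have equal rank, undoing the exchange keeps the win.\<close>
    then have "?X' - {y} \<union> {x} \<in> W"
      using desirability_exchange[of x y P W ?X'] rank[of x y] xy XP by auto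
    moreover have "?X' - {y} \<union> {x} = X" using xy by blast
    ultimately show ?thesis by simp
  next
    case False
    have packed: "f x \<le> f y" if "x \<in> X" "y \<in> P" "y \<notin> X" "r x = r y" for x y
      using False that by force
    have "k i \<le> card {x \<in> X. f x \<le> i}" if "i \<in> I" for i
    proof -
      obtain p where p: "p \<in> P" "f p = i" using I \<open>i \<in> I\<close> by blast
      have le: "r x \<le> r p" if "x \<in> P" "f x \<le> i" for x using refine that p by blast
      \<comment> \<open>Together with \<open>le\<close> this shows that the bound \<open>i\<close>
        on levels can cut only through the class of \<open>p\<close>: smaller ranks are fully
        counted, larger ones not at all.\<close>
      have lt: "f x \<le> i" if "x \<in> P" "r x < r p" for x
        using refine[of p x] p that by (metis leD nle_le)
      show ?thesis
      proof (cases "\<forall>x\<in>X. r x = r p \<longrightarrow> f x \<le> i")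
        case True
        \<comment> \<open>Here every player of \<open>X\<close> of rank at most \<open>r p\<close>
          has level at most \<open>i\<close>, so a minimizer at \<open>r p\<close> is the right
          comparison.\<close>
        obtain Y where Y: "Y \<in> W" "card (above Y (r p)) = least_above (r p)"
          using least_above_attained by blast
        note YP = winning_subset[OF Y(1)]
        have "k i \<le> card {x \<in> Y. f x \<le> i}" using Y(1) W \<open>i \<in> I\<close> by blast
        also have "\<dots> \<le> card (above Y (r p))"
          using le YP finite_above[OF YP] by (intro card_mono) (auto simp: above_def)
        also have "\<dots> \<le> card (above X (r p))" using Y less.prems by simp
        also have "\<dots> \<le> card {x \<in> X. f x \<le> i}"
        proof (intro card_mono subsetI)
          fix x assume "x \<in> above X (r p)"
          then have "x \<in> X" "r x < r p \<or> r x = r p" by (auto simp: above_def)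
          then show "x \<in> {x \<in> X. f x \<le> i}" using lt[of x] True XP by blast
        qed (use fin in simp)
        finally show ?thesis .
      next
        case False
        then obtain x where x: "x \<in> X" "r x = r p" "i < f x" by force
        let ?E = "{y \<in> P. r y = r p \<and> f y \<le> i}"
        have EX: "?E \<subseteq> X" using packed[OF x(1)] x by force
        \<comment> \<open>Here \<open>X\<close> contains \<open>?E\<close>, the largest possible
          contribution of the class of \<open>p\<close>, so only smaller ranks remain to be
          compared.\<close>
        obtain Y where Y: "Y \<in> W" "card {x \<in> Y. r x < r p} \<le> card {x \<in> X. r x < r p}"
          using card_below_ge less.prems by blast
        note YP = winning_subset[OF Y(1)]
        have "k i \<le> card {x \<in> Y. f x \<le> i}" using Y(1) W \<open>i \<in> I\<close> by blast
        also have "\<dots> \<le> card ({x \<in> Y. r x < r p} \<union> ?E)"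
          using le YP finite_coalition[OF YP] finite_P
          by (intro card_mono) (auto simp: le_less)
        also have "\<dots> \<le> card {x \<in> Y. r x < r p} + card ?E" by (rule card_Un_le)
        also have "\<dots> \<le> card {x \<in> X. r x < r p} + card ?E" using Y by simp
        also have "\<dots> = card ({x \<in> X. r x < r p} \<union> ?E)"
          using fin finite_P by (intro card_Un_disjoint[symmetric]) auto
        also have "\<dots> \<le> card {x \<in> X. f x \<le> i}"
          using EX lt XP fin by (intro card_mono) auto
        finally show ?thesis .
      qed
    qed
    then show ?thesis using W XP by blast
  qed
qed

lemma unique_shift_minimal_if_levels:
  fixes f :: "'a \<Rightarrow> nat"
  assumes W: "W = {X. X \<subseteq> P \<and> (\<forall>i\<in>I. k i \<le> card {x \<in> X. f x \<le> i})}"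
    and I: "I \<subseteq> f ` P"
    and refine: "\<And>p q. p \<in> P \<Longrightarrow> q \<in> P \<Longrightarrow> f p \<le> f q \<Longrightarrow> r p \<le> r q"
  shows "\<exists>!A. shift_minimal_winning (profile P) (profile ` W) A"
proof -
  obtain M where M: "M \<subseteq> P" "\<And>s. card (above M s) = least_above s"
    using least_above_realization by blast
  have "M \<in> W"
    by (rule winning_if_least_above_le[OF W I refine M(1)]) (simp_all add: M(2))
  then have "\<exists>M\<in>W. \<forall>X\<in>W. \<forall>s. card (above M s) \<le> card (above X s)"
    using M(2) least_above_le by metis
  then show ?thesis by (simp only: unique_shift_minimal_iff)
qed

lemma conjunctive_hierarchical_if_unique:
  assumes "{} \<notin> W" and range: "r ` P = {1..m}"
    and "\<exists>!A. shift_minimal_winning (profile P) (profile ` W) A"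
  shows "conjunctive_hierarchical P W"
  using assms(3) conjunctive_hierarchical_if_least[OF assms(1) range]
  unfolding unique_shift_minimal_iff by blast

end

section \<open>Rank functions from total preorders and class numberings\<close>

text \<open>The number of \<open>q\<close> with \<open>(q, p) \<in> D\<close> represents the
  preorder, but its values may have gaps; enumerating these values increasingly closes them.\<close>

lemma total_preorder_rank:
  assumes "finite P" "preorder_on P D" "total_on P D"
  obtains m and r :: "'a \<Rightarrow> nat" where "r ` P = {1..m}"
    "\<And>p q. p \<in> P \<Longrightarrow> q \<in> P \<Longrightarrow> (p, q) \<in> D \<longleftrightarrow> r p \<le> r q"
proof -
  have refl: "(p, p) \<in> D" if "p \<in> P" for p
    using assms(2) that by (auto simp: preorder_on_def refl_on_def)
  have trans: "(p, q) \<in> D \<Longrightarrow> (q, l) \<in> D \<Longrightarrow> (p, l) \<in> D" for p q l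
    using assms(2) by (auto simp: preorder_on_def dest: transD)
  have total: "(p, q) \<in> D \<or> (q, p) \<in> D" if "p \<in> P" "q \<in> P" for p q
    using assms(3) refl[OF that(1)] that unfolding total_on_def by (cases "p = q") auto
  define c where "c p = card {q \<in> P. (q, p) \<in> D}" for p
  have le: "c p \<le> c q" if "(p, q) \<in> D" for p q
    unfolding c_def using assms(1) trans that by (intro card_mono) auto
  have less: "c q < c p" if "p \<in> P" "q \<in> P" "(p, q) \<notin> D" for p q
  proof -
    have "(q, p) \<in> D" using total[OF that(1,2)] that(3) by blast
    then have "{l \<in> P. (l, q) \<in> D} \<subset> {l \<in> P. (l, p) \<in> D}"
      using trans refl[OF that(1)] that by blast
    then show ?thesis unfolding c_def using assms(1) by (intro psubset_card_mono) simp_all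
  qed
  have D: "(p, q) \<in> D \<longleftrightarrow> c p \<le> c q" if "p \<in> P" "q \<in> P" for p q
    using le less[OF that] by force
  obtain h where h: "bij_betw h {..<card (c ` P)} (c ` P)" "strict_mono_on {..<card (c ` P)} h"
    using ex_bij_betw_strict_mono_card[of "c ` P"] assms(1) by blast
  let ?g = "inv_into {..<card (c ` P)} h"
  \<comment> \<open>The enumeration \<open>h\<close> starts from index zero, whereas class numbers
    start at one.\<close>
  define r where "r p = Suc (?g (c p))" for p
  have hg: "h (?g (c p)) = c p" "?g (c p) \<in> {..<card (c ` P)}" if "p \<in> P" for p
  proof -
    have "c p \<in> h ` {..<card (c ` P)}" using h(1) that by (simp add: bij_betw_def)
    then show "h (?g (c p)) = c p" "?g (c p) \<in> {..<card (c ` P)}"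
      by (rule f_inv_into_f, rule inv_into_into)
  qed
  have "r ` P = Suc ` ?g ` c ` P" by (auto simp: r_def)
  also have "\<dots> = {1..card (c ` P)}"
    using bij_betw_inv_into[OF h(1)] by (simp add: bij_betw_def image_Suc_lessThan)
  finally have "r ` P = {1..card (c ` P)}" .
  moreover have "(p, q) \<in> D \<longleftrightarrow> r p \<le> r q" if "p \<in> P" "q \<in> P" for p q
    using D[OF that] strict_mono_on_less_eq[OF h(2) hg(2)[OF that(1)] hg(2)[OF that(2)]]
    by (simp add: hg(1) that r_def)
  ultimately show ?thesis using that by blast
qed

text \<open>The index of the class containing a player serves as its rank, which brings an arbitrary
  class numbering into the form of the locale.\<close>

lemma class_numbering_rank:
  assumes "simple_game P W" "complete_game P W" and num: "class_numbering P W m C"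
  obtains r where "ranked_game P W r" "r ` P = {1..m}"
    "\<And>i. i \<in> {1..m} \<Longrightarrow> C i = {p \<in> P. r p = i}"
proof -
  let ?D = "desirability P W" and ?E = "player_equivalence P W"
  have pre: "preorder_on P ?D" using assms(2) by (simp add: complete_game_def)
  then have E: "equiv P ?E"
    unfolding player_equivalence_def preorder_on_def
    by (intro equivI)
      (auto simp: refl_on_def desirability_def intro: sym_Int_converse trans_Int)
  have bij: "bij_betw C {1..m} (P // ?E)" using num by (simp add: class_numbering_def)
  have cls: "C i \<in> P // ?E" if "i \<in> {1..m}" for i using bij that by (auto simp: bij_betw_def)
  have ex: "\<exists>i. i \<in> {1..m} \<and> p \<in> C i" if "p \<in> P" for p
  proof -
    have "p \<in> ?E `` {p}" "?E `` {p} \<in> P // ?E"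
      using equiv_class_self[OF E that] quotientI[OF that] .
    then show ?thesis using bij by (metis bij_betw_def imageE)
  qed
  have uniq: "i = j" if "i \<in> {1..m}" "j \<in> {1..m}" "p \<in> C i" "p \<in> C j" for i j p
  proof -
    have "C i = C j" using quotient_disj[OF E cls[OF that(1)] cls[OF that(2)]] that(3,4) by blast
    then show ?thesis using bij that(1,2) unfolding bij_betw_def by (blast dest: inj_onD)
  qed
  define r where "r p = (SOME i. i \<in> {1..m} \<and> p \<in> C i)" for p
  have r: "r p \<in> {1..m}" "p \<in> C (r p)" if "p \<in> P" for p
    using someI_ex[OF ex[OF that]] unfolding r_def by blast+
  have sub: "C i \<subseteq> P" if "i \<in> {1..m}" for i
    using cls[OF that] E by (meson in_quotient_imp_subset)
  have C: "C i = {p \<in> P. r p = i}" if "i \<in> {1..m}" for i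
    using sub[OF that] r uniq[OF that] by blast
  have order: "(p, q) \<in> ?D \<and> (q, p) \<notin> ?D" if "p \<in> P" "q \<in> P" "r p < r q" for p q
    using num r that unfolding class_numbering_def by blast
  have same: "(p, q) \<in> ?D" if "p \<in> P" "q \<in> P" "r p = r q" for p q
  proof -
    have "q \<in> C (r p)" using r(2)[OF that(2)] that(3) by simp
    then have "(p, q) \<in> ?E"
      using quotient_eq_iff[OF E cls cls] r[OF that(1)] by blast
    then show ?thesis by (simp add: player_equivalence_def)
  qed
  have "r ` P = {1..m}"
  proof (intro equalityI subsetI)
    fix i assume i: "i \<in> {1..m}"
    have "C i \<noteq> {}" using cls[OF i] E by (rule in_quotient_imp_non_empty[rotated])
    then show "i \<in> r ` P" using C[OF i] by fastforce
  qed (use r in blast)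
  moreover have "ranked_game P W r"
  proof
    show "simple_game P W" by (rule assms)
    fix p q assume "p \<in> P" "q \<in> P"
    then show "(p, q) \<in> ?D \<longleftrightarrow> r p \<le> r q"
      using order same by (metis leD leI le_less)
  qed
  ultimately show ?thesis using that C by blast
qed

section \<open>Levels of hierarchical games\<close>

text \<open>The partition is encoded by the level index of each player; nonempty levels ensure that
  every threshold index is the level of some player.\<close>

lemma conjunctive_hierarchical_levels:
  assumes "conjunctive_hierarchical P W"
  obtains I k and f :: "'a \<Rightarrow> nat" where "I \<subseteq> f ` P"
    "W = {X. X \<subseteq> P \<and> (\<forall>i\<in>I. k i \<le> card {x \<in> X. f x \<le> i})}"
proof -
  obtain m k and L :: "nat \<Rightarrow> 'a set" where dis: "disjoint_family_on L {1..m}"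
    and ne: "\<And>i. i \<in> {1..m} \<Longrightarrow> L i \<noteq> {}" and P: "(\<Union>i\<in>{1..m}. L i) = P"
    and W: "W = {X. X \<subseteq> P \<and> (\<forall>i\<in>{1..m}. k i \<le> card (X \<inter> (\<Union>j\<in>{1..i}. L j)))}"
    using assms unfolding conjunctive_hierarchical_def by blast
  define f where "f p = (SOME i. i \<in> {1..m} \<and> p \<in> L i)" for p
  have f: "f p \<in> {1..m} \<and> p \<in> L (f p)" if "p \<in> P" for p
    unfolding f_def by (rule someI_ex) (use that P in blast)
  have L: "L i = {p \<in> P. f p = i}" if "i \<in> {1..m}" for i
    using f P that dis unfolding disjoint_family_on_def by blast
  have "X \<inter> (\<Union>j\<in>{1..i}. L j) = {x \<in> X. f x \<le> i}" if "X \<subseteq> P" "i \<in> {1..m}" for X i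
  proof -
    have "(\<Union>j\<in>{1..i}. L j) = (\<Union>j\<in>{1..i}. {p \<in> P. f p = j})" using L that(2) by simp
    also have "\<dots> = {p \<in> P. f p \<le> i}" using f by force
    finally show ?thesis using that(1) by blast
  qed
  then have "W = {X. X \<subseteq> P \<and> (\<forall>i\<in>{1..m}. k i \<le> card {x \<in> X. f x \<le> i})}"
    unfolding W by auto
  moreover have "{1..m} \<subseteq> f ` P" using ne L by fastforce
  ultimately show ?thesis using that by blast
qed

text \<open>Every threshold condition that counts \<open>q\<close> also counts \<open>p\<close>, so
  replacing \<open>q\<close> by \<open>p\<close> lowers no count.\<close>

lemma desirable_if_level_le:
  fixes f :: "'a \<Rightarrow> nat"
  assumes "finite P" and W: "W = {X. X \<subseteq> P \<and> (\<forall>i\<in>I. k i \<le> card {x \<in> X. f x \<le> i})}"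
    and pq: "p \<in> P" "q \<in> P" "f p \<le> f q"
  shows "(p, q) \<in> desirability P W"
proof (rule desirabilityI[OF pq(1,2)])
  fix X assume X: "X \<subseteq> P" "p \<notin> X" "q \<notin> X" "X \<union> {q} \<in> W"
  have fin: "finite {x \<in> X. f x \<le> i}" for i using assms(1) X(1) by (simp add: finite_subset)
  have ins: "card {x \<in> X \<union> {y}. f x \<le> i} = card {x \<in> X. f x \<le> i} + (if f y \<le> i then 1 else 0)"
    if "y \<notin> X" for y i
  proof -
    have "{x \<in> X \<union> {y}. f x \<le> i} =
      (if f y \<le> i then insert y {x \<in> X. f x \<le> i} else {x \<in> X. f x \<le> i})" by auto
    then show ?thesis using fin that by simp
  qed
  have "k i \<le> card {x \<in> X \<union> {p}. f x \<le> i}" if "i \<in> I" for i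
  proof -
    have "k i \<le> card {x \<in> X \<union> {q}. f x \<le> i}" using X(4) W that by blast
    also have "\<dots> \<le> card {x \<in> X \<union> {p}. f x \<le> i}"
      unfolding ins[OF X(2)] ins[OF X(3)] using pq(3) by auto
    finally show ?thesis .
  qed
  then show "X \<union> {p} \<in> W" using W X(1) pq(1) by blast
qed

text \<open>The assumption \<open>{} \<notin> W\<close> excludes the game in which all coalitions
  win: its only shift-minimal winning multiset is empty, while positive thresholds make the empty
  coalition lose.\<close>

theorem theorem8:
  fixes P :: "'a set" and W :: "'a set set"
  assumes "simple_game P W"
    and "{} \<notin> W"
  shows "conjunctive_hierarchical P W \<longleftrightarrow>
    complete_game P W \<and>
    (\<exists>m C. class_numbering P W m C \<and>
       (\<exists>!A. shift_minimal_winning (class_mset m C) (canonical_winning W m C) A))"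
proof
  assume "conjunctive_hierarchical P W"
  then obtain I k and f :: "'a \<Rightarrow> nat" where I: "I \<subseteq> f ` P"
    and W: "W = {X. X \<subseteq> P \<and> (\<forall>i\<in>I. k i \<le> card {x \<in> X. f x \<le> i})}"
    by (rule conjunctive_hierarchical_levels)
  have fin: "finite P" using assms(1) by (simp add: simple_game_def)
  note desirable = desirable_if_level_le[OF fin W]
  have complete: "complete_game P W"
    unfolding complete_game_def preorder_on_def
  proof (intro conjI)
    show "desirability P W \<subseteq> P \<times> P" by (auto simp: desirability_def)
    show "refl_on P (desirability P W)" by (auto simp: refl_on_def desirability_def)
    show "total_on P (desirability P W)"
    proof (rule total_onI)
      fix p q assume "p \<in> P" "q \<in> P"
      then show "(p, q) \<in> desirability P W \<or> (q, p) \<in> desirability P W"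
        using desirable[of p q] desirable[of q p] by linarith
    qed
  qed (rule trans_desirability)
  then have pre: "preorder_on P (desirability P W)" and tot: "total_on P (desirability P W)"
    by (simp_all add: complete_game_def)
  obtain m r where range: "r ` P = {1..m}"
    and rank: "\<And>p q. p \<in> P \<Longrightarrow> q \<in> P \<Longrightarrow> (p, q) \<in> desirability P W \<longleftrightarrow> r p \<le> (r q :: nat)"
    by (rule total_preorder_rank[OF fin pre tot]) (rule that)
  have ranked: "ranked_game P W r"
    by (rule ranked_game.intro) (use assms(1) rank in simp_all)
  \<comment> \<open>By \<open>desirable\<close>, a lower level never has a larger rank, so each
    class is a union of consecutive levels.\<close>
  have "\<exists>!A. shift_minimal_winning (ranked_game.profile r P) (ranked_game.profile r ` W) A"
    by (rule ranked_game.unique_shift_minimal_if_levels[OF ranked W I])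
      (use desirable rank in blast)
  then have "\<exists>!A. shift_minimal_winning (class_mset m (\<lambda>i. {p \<in> P. r p = i}))
      (canonical_winning W m (\<lambda>i. {p \<in> P. r p = i})) A"
    by (simp only: ranked_game.canonical_representation[OF ranked range refl])
  then show "complete_game P W \<and> (\<exists>m C. class_numbering P W m C \<and>
      (\<exists>!A. shift_minimal_winning (class_mset m C) (canonical_winning W m C) A))"
    using complete ranked_game.class_numbering_of_rank[OF ranked range] by blast
next
  assume "complete_game P W \<and> (\<exists>m C. class_numbering P W m C \<and>
      (\<exists>!A. shift_minimal_winning (class_mset m C) (canonical_winning W m C) A))"
  then obtain m C where complete: "complete_game P W" and num: "class_numbering P W m C"
    and uniq: "\<exists>!A. shift_minimal_winning (class_mset m C) (canonical_winning W m C) A"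
    by blast
  obtain r where ranked: "ranked_game P W r" and range: "r ` P = {1..m}"
    and C: "\<And>i. i \<in> {1..m} \<Longrightarrow> C i = {p \<in> P. r p = i}"
    using class_numbering_rank[OF assms(1) complete num] by blast
  have "\<exists>!A. shift_minimal_winning (ranked_game.profile r P) (ranked_game.profile r ` W) A"
    using uniq by (simp only: ranked_game.canonical_representation[OF ranked range C])
  then show "conjunctive_hierarchical P W"
    by (rule ranked_game.conjunctive_hierarchical_if_unique[OF ranked assms(2) range])
qed

end
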